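(* Let $G$ be a finite group and let $L$ be an involutive antiautomorphism of $G$ such that (i) $L(g)$ is conjugate to $g$ for all $g\in G$; (ii) $|\mathrm{Fix}_G(L)|=d_G$. If $G$ has a (non-trivial) central involution, i.e. an element of order $2$ in its centre, then the natural representation $(L^2(X),\tau)$ of $G$ associated to the $G$-space $X=\mathrm{Fix}_G(L)$ is not a Gelfand Model for $G$.
   Context: An involutive antiautomorphism of $G$ is a bijection $L:G\to G$ with $L(gh)=L(h)L(g)$ and $L(L(g))=g$ for all $g,h\in G$; $\mathrm{Fix}_G(L)=\{g\in G: L(g)=g\}$. $d_G$ is the sum of the dimensions of all irreducible complex representations of $G$ (each isomorphism class counted once). $G$ acts on $X=\mathrm{Fix}_G(L)$ by $g\cdot h=g^{-1}hL(g)^{-1}$ (a right action), and $\tau$ is the associated natural representation of $G$ on the space $L^2(X)$ of all functions $X\to\mathbb{C}$, namely $(\tau_g f)(h)=f(g^{-1}hL(g)^{-1})$ for $g\in G$, $h\in X$. A Gelfand Model for $G$ is a complex representation of $G$ isomorphic to the direct sum of all irreducible complex representations of $G$, each appearing exactly once. *)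

theory Defs
  imports
    Complex_Main
    "HOL-Library.Function_Algebras"
    "HOL-Algebra.Multiplicative_Group"
begin

section \<open>Complex vector spaces\<close>

class scaleC =
  fixes scaleC :: "complex \<Rightarrow> 'a \<Rightarrow> 'a" (infixr "*\<^sub>C" 75)

class complex_vector = scaleC + ab_group_add +
  assumes scaleC_add_right: "a *\<^sub>C (x + y) = a *\<^sub>C x + a *\<^sub>C y"
    and scaleC_add_left: "(a + b) *\<^sub>C x = a *\<^sub>C x + b *\<^sub>C x"
    and scaleC_scaleC: "a *\<^sub>C (b *\<^sub>C x) = (a * b) *\<^sub>C x"
    and scaleC_one: "1 *\<^sub>C x = x"

interpretation complex_vector: vector_space "scaleC :: complex \<Rightarrow> 'a \<Rightarrow> 'a :: complex_vector"
  by unfold_locales (simp_all add: scaleC_add_right scaleC_add_left scaleC_scaleC scaleC_one)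

instantiation complex :: complex_vector
begin

definition scaleC_complex :: "complex \<Rightarrow> complex \<Rightarrow> complex"
  where "scaleC_complex = (*)"

instance
  by standard (simp_all add: scaleC_complex_def algebra_simps)

end

instantiation "fun" :: (type, complex_vector) complex_vector
begin

definition scaleC_fun :: "complex \<Rightarrow> ('a \<Rightarrow> 'b) \<Rightarrow> 'a \<Rightarrow> 'b"
  where "scaleC_fun c f = (\<lambda>x. c *\<^sub>C f x)"

instance
  by standard (simp_all add: scaleC_fun_def fun_eq_iff
    scaleC_add_right scaleC_add_left scaleC_scaleC scaleC_one)

end

lemma scaleC_fun_apply [simp]: "(c *\<^sub>C f) x = c *\<^sub>C f x"
  by (simp add: scaleC_fun_def)

definition clinear_on :: "'v::complex_vector set \<Rightarrow> ('v \<Rightarrow> 'w::complex_vector) \<Rightarrow> bool"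
  where "clinear_on V T \<longleftrightarrow>
    (\<forall>u\<in>V. \<forall>v\<in>V. T (u + v) = T u + T v) \<and> (\<forall>c. \<forall>v\<in>V. T (c *\<^sub>C v) = c *\<^sub>C T v)"


section \<open>Complex representations\<close>

text \<open>The underlying space of a representation is a subspace of a type of class
  \<^class>\<open>complex_vector\<close>. Values of the action at arguments outside the group or outside
  the space are irrelevant.\<close>

record ('g, 'v) crep =
  space :: "'v set"
  act :: "'g \<Rightarrow> 'v \<Rightarrow> 'v"

definition complex_rep :: "('g, 'm) monoid_scheme \<Rightarrow> ('g, 'v::complex_vector) crep \<Rightarrow> bool"
  where "complex_rep G R \<longleftrightarrow>
    complex_vector.subspace (space R) \<and>
    (\<forall>g\<in>carrier G. clinear_on (space R) (act R g) \<and> act R g ` space R \<subseteq> space R) \<and>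
    (\<forall>g\<in>carrier G. \<forall>h\<in>carrier G. \<forall>v\<in>space R.
      act R (g \<otimes>\<^bsub>G\<^esub> h) v = act R g (act R h v)) \<and>
    (\<forall>v\<in>space R. act R \<one>\<^bsub>G\<^esub> v = v)"

definition irreducible_rep :: "('g, 'm) monoid_scheme \<Rightarrow> ('g, 'v::complex_vector) crep \<Rightarrow> bool"
  where "irreducible_rep G R \<longleftrightarrow>
    complex_rep G R \<and> space R \<noteq> {0} \<and>
    (\<forall>W. complex_vector.subspace W \<and> W \<subseteq> space R \<and> (\<forall>g\<in>carrier G. act R g ` W \<subseteq> W)
      \<longrightarrow> W = {0} \<or> W = space R)"

definition rep_iso :: "('g, 'm) monoid_scheme \<Rightarrow> ('g, 'v::complex_vector) crep \<Rightarrow>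
    ('g, 'w::complex_vector) crep \<Rightarrow> bool"
  where "rep_iso G R S \<longleftrightarrow>
    (\<exists>T. clinear_on (space R) T \<and> bij_betw T (space R) (space S) \<and>
      (\<forall>g\<in>carrier G. \<forall>v\<in>space R. T (act R g v) = act S g (T v)))"

definition direct_sum :: "'i set \<Rightarrow> ('i \<Rightarrow> ('g, 'v::complex_vector) crep) \<Rightarrow> ('g, 'i \<Rightarrow> 'v) crep"
  where "direct_sum I R = \<lparr>
    space = {u. finite {i. u i \<noteq> 0} \<and> (\<forall>i\<in>I. u i \<in> space (R i)) \<and> (\<forall>i. i \<notin> I \<longrightarrow> u i = 0)},
    act = (\<lambda>g u i. if i \<in> I then act (R i) g (u i) else 0)\<rparr>"

text \<open>Irreducible representations of a finite group are finite-dimensional, so each of them is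
  isomorphic to one carried by a subspace of \<^typ>\<open>nat \<Rightarrow> complex\<close>. Hence the
  isomorphism classes below are all the isomorphism classes of irreducible complex
  representations of a finite group.\<close>

definition irreps :: "('g, 'm) monoid_scheme \<Rightarrow> ('g, nat \<Rightarrow> complex) crep set"
  where "irreps G = {R. irreducible_rep G R}"

definition irrep_classes :: "('g, 'm) monoid_scheme \<Rightarrow> ('g, nat \<Rightarrow> complex) crep set set"
  where "irrep_classes G = irreps G // {(R, S). R \<in> irreps G \<and> S \<in> irreps G \<and> rep_iso G R S}"

definition class_rep :: "('g, nat \<Rightarrow> complex) crep set \<Rightarrow> ('g, nat \<Rightarrow> complex) crep"
  where "class_rep C = (SOME R. R \<in> C)"

definition sum_irrep_dims :: "('g, 'm) monoid_scheme \<Rightarrow> nat"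
  where "sum_irrep_dims G = (\<Sum>C\<in>irrep_classes G. complex_vector.dim (space (class_rep C)))"

definition gelfand_model :: "('g, 'm) monoid_scheme \<Rightarrow> ('g, 'v::complex_vector) crep \<Rightarrow> bool"
  where "gelfand_model G R \<longleftrightarrow>
    complex_rep G R \<and> rep_iso G R (direct_sum (irrep_classes G) class_rep)"


section \<open>Involutive antiautomorphisms and the associated representation\<close>

definition involutive_antiaut :: "('g, 'm) monoid_scheme \<Rightarrow> ('g \<Rightarrow> 'g) \<Rightarrow> bool"
  where "involutive_antiaut G L \<longleftrightarrow>
    bij_betw L (carrier G) (carrier G) \<and>
    (\<forall>g\<in>carrier G. \<forall>h\<in>carrier G. L (g \<otimes>\<^bsub>G\<^esub> h) = L h \<otimes>\<^bsub>G\<^esub> L g) \<and>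
    (\<forall>g\<in>carrier G. L (L g) = g)"

definition Fix :: "('g, 'm) monoid_scheme \<Rightarrow> ('g \<Rightarrow> 'g) \<Rightarrow> 'g set"
  where "Fix G L = {g \<in> carrier G. L g = g}"

definition twisted_action :: "('g, 'm) monoid_scheme \<Rightarrow> ('g \<Rightarrow> 'g) \<Rightarrow> 'g \<Rightarrow> 'g \<Rightarrow> 'g"
  where "twisted_action G L g h = inv\<^bsub>G\<^esub> g \<otimes>\<^bsub>G\<^esub> h \<otimes>\<^bsub>G\<^esub> inv\<^bsub>G\<^esub> (L g)"

text \<open>Functions on \<^term>\<open>X = Fix G L\<close> are represented by their extensions by zero.\<close>

definition natural_rep :: "('g, 'm) monoid_scheme \<Rightarrow> ('g \<Rightarrow> 'g) \<Rightarrow> ('g, 'g \<Rightarrow> complex) crep"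
  where "natural_rep G L = \<lparr>
    space = {f. \<forall>h. h \<notin> Fix G L \<longrightarrow> f h = 0},
    act = (\<lambda>g f h. if h \<in> Fix G L then f (twisted_action G L g h) else 0)\<rparr>"


section \<open>Well-definedness\<close>

lemma rep_iso_refl: "rep_iso G R R"
  unfolding rep_iso_def clinear_on_def by (rule exI[of _ id]) auto

lemma rep_iso_trans:
  assumes "complex_rep G R" "rep_iso G R S" "rep_iso G S U"
  shows "rep_iso G R U"
proof -
  obtain T where T: "clinear_on (space R) T" "bij_betw T (space R) (space S)"
    "\<forall>g\<in>carrier G. \<forall>v\<in>space R. T (act R g v) = act S g (T v)"
    using assms(2) unfolding rep_iso_def by blast
  obtain T' where T': "clinear_on (space S) T'" "bij_betw T' (space S) (space U)"
    "\<forall>g\<in>carrier G. \<forall>v\<in>space S. T' (act S g v) = act U g (T' v)"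
    using assms(3) unfolding rep_iso_def by blast
  have mem: "T v \<in> space S" if "v \<in> space R" for v
    using T(2) that by (auto simp: bij_betw_def)
  show ?thesis
    unfolding rep_iso_def
  proof (intro exI[of _ "T' \<circ> T"] conjI)
    show "clinear_on (space R) (T' \<circ> T)"
      using T(1) T'(1) mem by (simp add: clinear_on_def)
    show "bij_betw (T' \<circ> T) (space R) (space U)"
      using T(2) T'(2) by (rule bij_betw_trans)
    show "\<forall>g\<in>carrier G. \<forall>v\<in>space R. (T' \<circ> T) (act R g v) = act U g ((T' \<circ> T) v)"
      using T(3) T'(3) mem by simp
  qed
qed

lemma rep_iso_sym:
  assumes R: "complex_rep G R" and iso: "rep_iso G R S"
  shows "rep_iso G S R"
proof -
  obtain T where T: "clinear_on (space R) T" "bij_betw T (space R) (space S)"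
    "\<forall>g\<in>carrier G. \<forall>v\<in>space R. T (act R g v) = act S g (T v)"
    using iso unfolding rep_iso_def by blast
  define T' where "T' = inv_into (space R) T"
  have bij: "bij_betw T' (space S) (space R)"
    unfolding T'_def using T(2) by (rule bij_betw_inv_into)
  have mem: "T' w \<in> space R" if "w \<in> space S" for w
    using bij that by (auto simp: bij_betw_def)
  have TT': "T (T' w) = w" if "w \<in> space S" for w
    unfolding T'_def using T(2) that by (rule bij_betw_inv_into_right)
  have T'T: "T' (T v) = v" if "v \<in> space R" for v
    unfolding T'_def using T(2) that by (rule bij_betw_inv_into_left)
  have sub: "complex_vector.subspace (space R)"
    using R by (simp add: complex_rep_def)
  have add: "T' (u + v) = T' u + T' v" if "u \<in> space S" "v \<in> space S" for u v
  proof -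
    have "T (T' u + T' v) = u + v"
      using T(1) mem that TT' by (simp add: clinear_on_def)
    moreover have "T' u + T' v \<in> space R"
      using sub mem that by (simp add: complex_vector.subspace_add)
    ultimately show ?thesis using T'T by metis
  qed
  have scl: "T' (c *\<^sub>C u) = c *\<^sub>C T' u" if "u \<in> space S" for c u
  proof -
    have "T (c *\<^sub>C T' u) = c *\<^sub>C u"
      using T(1) mem that TT' by (simp add: clinear_on_def)
    moreover have "c *\<^sub>C T' u \<in> space R"
      using sub mem that by (simp add: complex_vector.subspace_scale)
    ultimately show ?thesis using T'T by metis
  qed
  have equiv: "T' (act S g w) = act R g (T' w)" if "g \<in> carrier G" "w \<in> space S" for g w
  proof -
    have "T (act R g (T' w)) = act S g w"
      using T(3) mem that TT' by simp
    moreover have "act R g (T' w) \<in> space R"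
      using R mem that unfolding complex_rep_def by blast
    ultimately show ?thesis using T'T by metis
  qed
  show ?thesis
    unfolding rep_iso_def clinear_on_def using bij add scl equiv by blast
qed

lemma equiv_rep_iso_irreps:
  "equiv (irreps G) {(R, S). R \<in> irreps G \<and> S \<in> irreps G \<and> rep_iso G R S}"
proof (rule equivI)
  have crep: "complex_rep G R" if "R \<in> irreps G" for R
    using that by (simp add: irreps_def irreducible_rep_def)
  show "{(R, S). R \<in> irreps G \<and> S \<in> irreps G \<and> rep_iso G R S} \<subseteq> irreps G \<times> irreps G"
    by blast
  show "refl_on (irreps G) {(R, S). R \<in> irreps G \<and> S \<in> irreps G \<and> rep_iso G R S}"
    by (auto simp: refl_on_def rep_iso_refl)
  show "sym {(R, S). R \<in> irreps G \<and> S \<in> irreps G \<and> rep_iso G R S}"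
    using rep_iso_sym crep unfolding sym_def by blast
  show "trans {(R, S). R \<in> irreps G \<and> S \<in> irreps G \<and> rep_iso G R S}"
    using rep_iso_trans[OF crep] unfolding trans_def by blast
qed

lemma class_rep_in:
  assumes "C \<in> irrep_classes G"
  shows "class_rep C \<in> C"
proof -
  have "C \<noteq> {}"
    using in_quotient_imp_non_empty[OF equiv_rep_iso_irreps] assms
    unfolding irrep_classes_def by blast
  then show ?thesis
    unfolding class_rep_def by (simp add: some_in_eq)
qed

lemma complex_rep_direct_sum:
  assumes "\<And>i. i \<in> I \<Longrightarrow> complex_rep G (R i)"
  shows "complex_rep G (direct_sum I R)"
proof -
  have sub: "complex_vector.subspace (space (R i))" if "i \<in> I" for i
    using assms[OF that] by (simp add: complex_rep_def)
  have act0: "act (R i) g 0 = 0" if "i \<in> I" "g \<in> carrier G" for i g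
  proof -
    have "0 \<in> space (R i)" using sub[OF that(1)] by (rule complex_vector.subspace_0)
    then have "act (R i) g (0 *\<^sub>C 0) = 0 *\<^sub>C act (R i) g 0"
      using assms[OF that(1)] that(2) unfolding complex_rep_def clinear_on_def by blast
    then show ?thesis by simp
  qed
  have fin: "finite {i. (if i \<in> I then act (R i) g (u i) else 0) \<noteq> 0}"
    if "finite {i. u i \<noteq> 0}" "g \<in> carrier G" for g and u :: "'a \<Rightarrow> 'd"
  proof (rule finite_subset[OF _ that(1)])
    show "{i. (if i \<in> I then act (R i) g (u i) else 0) \<noteq> 0} \<subseteq> {i. u i \<noteq> 0}"
      using act0 that(2) by auto
  qed
  have "complex_vector.subspace (space (direct_sum I R))"
    unfolding complex_vector.subspace_def
  proof (intro conjI allI ballI)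
    show "0 \<in> space (direct_sum I R)"
      using sub by (simp add: direct_sum_def complex_vector.subspace_0)
  next
    fix u v assume u: "u \<in> space (direct_sum I R)" and v: "v \<in> space (direct_sum I R)"
    have "finite ({i. u i \<noteq> 0} \<union> {i. v i \<noteq> 0})"
      using u v by (simp add: direct_sum_def)
    then have "finite {i. u i + v i \<noteq> 0}"
      by (rule rev_finite_subset) auto
    then show "u + v \<in> space (direct_sum I R)"
      using u v sub by (simp add: direct_sum_def complex_vector.subspace_add)
  next
    fix c u assume u: "u \<in> space (direct_sum I R)"
    have "finite {i. u i \<noteq> 0}"
      using u by (simp add: direct_sum_def)
    then have "finite {i. c *\<^sub>C u i \<noteq> 0}"
      by (rule rev_finite_subset) auto
    then show "c *\<^sub>C u \<in> space (direct_sum I R)"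
      using u sub by (simp add: direct_sum_def complex_vector.subspace_scale)
  qed
  moreover have "clinear_on (space (direct_sum I R)) (act (direct_sum I R) g)"
    if "g \<in> carrier G" for g
    using assms that by (simp add: clinear_on_def direct_sum_def complex_rep_def fun_eq_iff)
  moreover have "act (direct_sum I R) g ` space (direct_sum I R) \<subseteq> space (direct_sum I R)"
    if g: "g \<in> carrier G" for g
  proof
    fix w assume "w \<in> act (direct_sum I R) g ` space (direct_sum I R)"
    then obtain u where u: "u \<in> space (direct_sum I R)"
      and w: "w = (\<lambda>i. if i \<in> I then act (R i) g (u i) else 0)"
      by (auto simp: direct_sum_def)
    have "act (R i) g (u i) \<in> space (R i)" if "i \<in> I" for i
      using assms[OF that] g u that unfolding complex_rep_def direct_sum_def by auto
    then show "w \<in> space (direct_sum I R)"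
      using fin[OF _ g, of u] u by (simp add: direct_sum_def w)
  qed
  moreover have "act (direct_sum I R) (g \<otimes>\<^bsub>G\<^esub> h) u = act (direct_sum I R) g (act (direct_sum I R) h u)"
    if "g \<in> carrier G" "h \<in> carrier G" "u \<in> space (direct_sum I R)" for g h u
    using assms that by (simp add: direct_sum_def complex_rep_def fun_eq_iff)
  moreover have "act (direct_sum I R) \<one>\<^bsub>G\<^esub> u = u" if "u \<in> space (direct_sum I R)" for u
    using assms that by (auto simp add: direct_sum_def complex_rep_def fun_eq_iff)
  ultimately show ?thesis
    unfolding complex_rep_def by blast
qed

lemma involutive_antiaut_props:
  assumes "group G" "involutive_antiaut G L"
  shows "\<And>g. g \<in> carrier G \<Longrightarrow> L g \<in> carrier G"
    and "\<And>g h. g \<in> carrier G \<Longrightarrow> h \<in> carrier G \<Longrightarrow> L (g \<otimes>\<^bsub>G\<^esub> h) = L h \<otimes>\<^bsub>G\<^esub> L g"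
    and "\<And>g. g \<in> carrier G \<Longrightarrow> L (L g) = g"
    and "L \<one>\<^bsub>G\<^esub> = \<one>\<^bsub>G\<^esub>"
    and "\<And>g. g \<in> carrier G \<Longrightarrow> L (inv\<^bsub>G\<^esub> g) = inv\<^bsub>G\<^esub> (L g)"
proof -
  interpret group G by fact
  show cl: "L g \<in> carrier G" if "g \<in> carrier G" for g
    using assms(2) that by (auto simp: involutive_antiaut_def bij_betw_def)
  show mult: "L (g \<otimes>\<^bsub>G\<^esub> h) = L h \<otimes>\<^bsub>G\<^esub> L g" if "g \<in> carrier G" "h \<in> carrier G" for g h
    using assms(2) that by (simp add: involutive_antiaut_def)
  show "L (L g) = g" if "g \<in> carrier G" for g
    using assms(2) that by (simp add: involutive_antiaut_def)
  have "L \<one>\<^bsub>G\<^esub> \<otimes>\<^bsub>G\<^esub> L \<one>\<^bsub>G\<^esub> = L \<one>\<^bsub>G\<^esub>"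
    using mult[of "\<one>\<^bsub>G\<^esub>" "\<one>\<^bsub>G\<^esub>"] by simp
  then show one: "L \<one>\<^bsub>G\<^esub> = \<one>\<^bsub>G\<^esub>"
    using cl[of "\<one>\<^bsub>G\<^esub>"] by (metis l_cancel_one one_closed)
  show "L (inv\<^bsub>G\<^esub> g) = inv\<^bsub>G\<^esub> (L g)" if "g \<in> carrier G" for g
  proof -
    have "L (inv\<^bsub>G\<^esub> g) \<otimes>\<^bsub>G\<^esub> L g = \<one>\<^bsub>G\<^esub>"
      using mult[of g "inv\<^bsub>G\<^esub> g"] that one by simp
    then show ?thesis using that cl by (metis inv_equality inv_closed)
  qed
qed

lemma twisted_action_closed:
  assumes "group G" "involutive_antiaut G L" "g \<in> carrier G" "h \<in> Fix G L"
  shows "twisted_action G L g h \<in> Fix G L"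
proof -
  interpret group G by fact
  note props = involutive_antiaut_props[OF assms(1,2)]
  show ?thesis
    using assms(3,4) props by (simp add: Fix_def twisted_action_def m_assoc)
qed

lemma twisted_action_mult:
  assumes "group G" "involutive_antiaut G L" "g \<in> carrier G" "k \<in> carrier G" "h \<in> Fix G L"
  shows "twisted_action G L (g \<otimes>\<^bsub>G\<^esub> k) h = twisted_action G L k (twisted_action G L g h)"
proof -
  interpret group G by fact
  note props = involutive_antiaut_props[OF assms(1,2)]
  show ?thesis
    using assms(3,4,5) props by (simp add: Fix_def twisted_action_def m_assoc inv_mult_group)
qed

lemma complex_rep_natural_rep:
  assumes "group G" "involutive_antiaut G L"
  shows "complex_rep G (natural_rep G L)"
proof -
  interpret group G by fact
  note props = involutive_antiaut_props[OF assms]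
  have one: "twisted_action G L \<one>\<^bsub>G\<^esub> h = h" if "h \<in> Fix G L" for h
    using that props(4) by (simp add: Fix_def twisted_action_def)
  show ?thesis
    unfolding complex_rep_def complex_vector.subspace_def clinear_on_def
    by (auto simp: natural_rep_def fun_eq_iff one twisted_action_closed[OF assms]
        twisted_action_mult[OF assms])
qed

end

theory Submission
  imports Defs
begin

text \<open>A central involution \<open>z\<close> satisfies \<open>L z = z\<close>, because \<open>L z\<close> is conjugate to \<open>z\<close>; hence
  \<open>\<tau> z f h = f (z\<inverse> h z\<inverse>) = f h\<close>, so \<open>z\<close> acts trivially on the natural representation. In a
  Gelfand model it would thus act trivially on every irreducible representation. But \<open>z\<close> acts as
  \<open>-1\<close> on the nonzero invariant subspace \<open>{u. u (z h) = - u h}\<close> of the regular representation, and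
  therefore on any irreducible representation contained in it.\<close>

lemma complex_rep_invariant_subspace:
  assumes "complex_rep G R" "complex_vector.subspace W" "W \<subseteq> space R"
    and "\<And>g. g \<in> carrier G \<Longrightarrow> act R g ` W \<subseteq> W"
  shows "complex_rep G \<lparr>space = W, act = act R\<rparr>"
proof -
  have "v \<in> space R" if "v \<in> W" for v using that assms(3) by blast
  then show ?thesis
    using assms(1,2,4) unfolding complex_rep_def clinear_on_def by simp
qed

text \<open>A basis \<open>C\<close> of \<open>W\<close> stays independent when a vector of
  \<open>V\<close> outside \<open>W\<close> is added, so by the exchange bound a basis
  \<open>D\<close> of \<open>V\<close> has at least one more element. This strict drop is what makes
  the induction in \<open>exists_irreducible_subrep\<close> terminate.\<close>

lemma dim_strict_mono_subspace:
  fixes V W :: "'v::complex_vector set"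
  assumes "complex_vector.subspace W" "W \<subset> V" "V \<subseteq> complex_vector.span B" "finite B"
  shows "complex_vector.dim W < complex_vector.dim V"
proof -
  obtain C where C: "C \<subseteq> W" "complex_vector.independent C" "W \<subseteq> complex_vector.span C"
      "card C = complex_vector.dim W"
    using complex_vector.basis_exists by blast
  obtain D where D: "D \<subseteq> V" "complex_vector.independent D" "V \<subseteq> complex_vector.span D"
      "card D = complex_vector.dim V"
    using complex_vector.basis_exists by blast
  obtain x where x: "x \<in> V" "x \<notin> W" using assms(2) by blast
  \<comment> \<open>\<open>D\<close> is independent inside the span of the finite set
    \<open>B\<close>. Finiteness matters because \<open>card\<close> is 0 on infinite sets.\<close>
  have finD: "finite D"
    using complex_vector.independent_span_bound[OF assms(4) D(2)] D(1) assms(3) by blast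
  have "complex_vector.span C \<subseteq> W"
    using C(1) assms(1) by (rule complex_vector.span_minimal)
  then have x': "x \<notin> complex_vector.span C" using x(2) by blast
  then have "complex_vector.independent (insert x C)"
    using C(2) by (simp add: complex_vector.independent_insert)
  moreover have "insert x C \<subseteq> complex_vector.span D"
    using x(1) C(1) D(3) assms(2) by blast
  ultimately have b: "finite (insert x C) \<and> card (insert x C) \<le> card D"
    by (rule complex_vector.independent_span_bound[OF finD])
  have "x \<notin> C" using x' complex_vector.span_base by blast
  then show ?thesis using b C(4) D(4) by auto
qed

text \<open>Strong induction on the dimension: a nonzero representation that is not irreducible has
  a nonzero proper invariant subspace, and the restriction to it has smaller dimension. The spanning
  set \<open>B\<close> stays fixed, since it also spans a space containing every subspace met on the
  way down.\<close>

lemma exists_irreducible_subrep: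
  fixes R :: "('g, 'v::complex_vector) crep"
  assumes "complex_rep G R" "space R \<noteq> {0}"
    and "space R \<subseteq> complex_vector.span B" "finite B"
  shows "\<exists>W\<subseteq>space R. irreducible_rep G \<lparr>space = W, act = act R\<rparr>"
  using assms(1-3)
proof (induction "complex_vector.dim (space R)" arbitrary: R rule: less_induct)
  case less
  show ?case
  proof (cases "irreducible_rep G R")
    case True
    then have "irreducible_rep G \<lparr>space = space R, act = act R\<rparr>"
      by (simp add: irreducible_rep_def complex_rep_def)
    then show ?thesis by blast
  next
    case False
    then obtain W where W: "complex_vector.subspace W" "W \<subseteq> space R"
        "\<And>g. g \<in> carrier G \<Longrightarrow> act R g ` W \<subseteq> W" "W \<noteq> {0}" "W \<noteq> space R"
      using less.prems(1,2) unfolding irreducible_rep_def by blast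
    let ?S = "\<lparr>space = W, act = act R\<rparr>"
    have "complex_vector.dim (space ?S) < complex_vector.dim (space R)"
      using dim_strict_mono_subspace[OF W(1) _ less.prems(3) assms(4)] W(2,5) by auto
    moreover have "complex_rep G ?S"
      using complex_rep_invariant_subspace[OF less.prems(1) W(1-3)] .
    ultimately have "\<exists>U\<subseteq>space ?S. irreducible_rep G \<lparr>space = U, act = act ?S\<rparr>"
      by (rule less.hyps) (use W less.prems in auto)
    then show ?thesis using W(2) by auto
  qed
qed

text \<open>Expansion in the first \<open>n\<close> coordinate vectors. This supplies the finite
  spanning set required by \<open>exists_irreducible_subrep\<close>.\<close>

lemma finitely_supported_in_span:
  "{u :: nat \<Rightarrow> complex. \<forall>i\<ge>n. u i = 0} \<subseteq>
     complex_vector.span ((\<lambda>i j. if j = i then 1 else 0) ` {..<n})"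
proof
  fix u :: "nat \<Rightarrow> complex" assume "u \<in> {u. \<forall>i\<ge>n. u i = 0}"
  then have u: "\<forall>i\<ge>n. u i = 0" by simp
  define e where "e = (\<lambda>i j :: nat. if j = i then 1 else 0 :: complex)"
  have app: "(\<Sum>i\<in>A. u i *\<^sub>C e i) j = (\<Sum>i\<in>A. u i * e i j)" if "finite A" for A j
    using that by induction (auto simp: scaleC_complex_def)
  have "u = (\<Sum>i<n. u i *\<^sub>C e i)"
  proof
    fix j
    show "u j = (\<Sum>i<n. u i *\<^sub>C e i) j"
      using u unfolding app[OF finite_lessThan] by (simp add: e_def if_distrib[of "(*) _"] cong: if_cong)
  qed
  moreover have "(\<Sum>i<n. u i *\<^sub>C e i) \<in> complex_vector.span (e ` {..<n})"
    by (intro complex_vector.span_sum complex_vector.span_scale complex_vector.span_base) auto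
  ultimately show "u \<in> complex_vector.span ((\<lambda>i j. if j = i then 1 else 0) ` {..<n})"
    unfolding e_def by simp
qed

lemma exists_irrep_central_involution_acts_as_minus:
  fixes G (structure)
  assumes "group G" "finite (carrier G)"
    and z: "z \<in> carrier G" "z \<otimes> z = \<one>" "z \<noteq> \<one>"
    and central: "\<And>g. g \<in> carrier G \<Longrightarrow> z \<otimes> g = g \<otimes> z"
  shows "\<exists>R\<in>irreps G. \<forall>v\<in>space R. act R z v = - v"
proof -
  interpret group G by fact
  define n where "n = card (carrier G)"
  \<comment> \<open>Members of \<open>irreps G\<close> live in \<open>nat => complex\<close>, so
    functions on the group are transported along a numbering \<open>e\<close> with inverse
    \<open>d\<close>.\<close>
  obtain e where e: "bij_betw e (carrier G) {..<n}"
    using ex_bij_betw_finite_nat[OF assms(2)] by (auto simp: n_def atLeast0LessThan)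
  define d where "d = inv_into (carrier G) e"
  have d: "d i \<in> carrier G" if "i < n" for i
    using that e unfolding d_def bij_betw_def by (metis inv_into_into lessThan_iff)
  have de: "d (e g) = g" if "g \<in> carrier G" for g
    using that e by (simp add: d_def bij_betw_inv_into_left)
  have ed: "e (d i) = i" if "i < n" for i
    using that e by (simp add: d_def bij_betw_inv_into_right)
  have elt: "e g < n" if "g \<in> carrier G" for g
    using that e by (auto simp: bij_betw_def)
  define V :: "(nat \<Rightarrow> complex) set"
    where "V = {u. (\<forall>i\<ge>n. u i = 0) \<and> (\<forall>h\<in>carrier G. u (e (z \<otimes> h)) = - u (e h))}"
  \<comment> \<open>Left translation of the regular representation, written in coordinates. The
    value 0 from \<open>n\<close> on keeps the result among the functions supported below
    \<open>n\<close>.\<close>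
  define a where "a = (\<lambda>g (u :: nat \<Rightarrow> complex) i. if i < n then u (e (inv g \<otimes> d i)) else 0)"
  let ?R = "\<lparr>space = V, act = a\<rparr>"
  have "complex_vector.subspace V"
    by (auto simp: complex_vector.subspace_def V_def scaleC_complex_def)
  moreover have "a g u \<in> V" if g: "g \<in> carrier G" and u: "u \<in> V" for g u
  proof -
    have "a g u (e (z \<otimes> h)) = - a g u (e h)" if h: "h \<in> carrier G" for h
    proof -
      \<comment> \<open>Centrality enters here: translations commute with multiplication by
        \<open>z\<close>, so they preserve the sign condition defining \<open>V\<close>.\<close>
      have "inv g \<otimes> (z \<otimes> h) = z \<otimes> (inv g \<otimes> h)"
        using central[of "inv g"] g h z(1) by (simp flip: m_assoc)
      then show ?thesis
        using u g h z(1) by (simp add: a_def V_def elt de)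
    qed
    then show ?thesis by (simp add: V_def a_def)
  qed
  moreover have "a (g \<otimes> h) u = a g (a h u)"
    if "g \<in> carrier G" "h \<in> carrier G" "u \<in> V" for g h u
    using that by (auto simp: a_def fun_eq_iff elt de d inv_mult_group m_assoc)
  moreover have "a \<one> u = u" if "u \<in> V" for u
    using that by (auto simp: a_def fun_eq_iff d ed V_def)
  moreover have "clinear_on V (a g)" for g
    by (auto simp: clinear_on_def a_def fun_eq_iff scaleC_complex_def)
  ultimately have rep: "complex_rep G ?R"
    by (auto simp: complex_rep_def)
  have inv_z: "inv z = z" using z by (simp add: inv_equality)
  have minus: "a z u = - u" if u: "u \<in> V" for u
  proof
    fix i
    show "a z u i = (- u) i"
    proof (cases "i < n")
      case True
      then have "u (e (z \<otimes> d i)) = - u (e (d i))" using u d by (simp add: V_def)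
      then show ?thesis using True by (simp add: a_def inv_z ed)
    qed (use u in \<open>simp add: a_def V_def\<close>)
  qed
  \<comment> \<open>The difference of the indicator functions of the identity and of
    \<open>z\<close>, a nonzero element of \<open>V\<close>. Multiplication by \<open>z\<close>
    swaps these two points and hence negates \<open>w\<close>.\<close>
  define w :: "nat \<Rightarrow> complex"
    where "w = (\<lambda>i. if i = e \<one> then 1 else if i = e z then -1 else 0)"
  have e_eq: "e g = e h \<longleftrightarrow> g = h" if "g \<in> carrier G" "h \<in> carrier G" for g h
    using that de by metis
  have "w (e (z \<otimes> h)) = - w (e h)" if h: "h \<in> carrier G" for h
  proof -
    have "z \<otimes> h = \<one> \<longleftrightarrow> h = z"
      using h z inv_z by (metis inv_equality inv_inv central)
    moreover have "z \<otimes> h = z \<longleftrightarrow> h = \<one>"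
      using h z by simp
    ultimately show ?thesis
      using h z by (simp add: w_def e_eq)
  qed
  then have "w \<in> V"
    using elt[OF one_closed] elt[OF z(1)] by (auto simp: V_def w_def)
  moreover have "w \<noteq> 0" by (auto simp: w_def fun_eq_iff)
  ultimately have "space ?R \<noteq> {0}" by auto
  moreover have "space ?R \<subseteq> complex_vector.span ((\<lambda>i j. if j = i then 1 else 0) ` {..<n})"
    using finitely_supported_in_span[of n] by (auto simp: V_def)
  ultimately have "\<exists>W\<subseteq>space ?R. irreducible_rep G \<lparr>space = W, act = act ?R\<rparr>"
    by (rule exists_irreducible_subrep[OF rep]) simp
  then obtain W where "W \<subseteq> V" "irreducible_rep G \<lparr>space = W, act = a\<rparr>"
    by auto
  then show ?thesis
    using minus by (intro bexI[of _ "\<lparr>space = W, act = a\<rparr>"]) (auto simp: irreps_def)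
qed

lemma rep_iso_acts_trivially:
  assumes "complex_rep G R" "rep_iso G R S" "g \<in> carrier G"
    and "\<And>v. v \<in> space R \<Longrightarrow> act R g v = v" and "w \<in> space S"
  shows "act S g w = w"
proof -
  obtain T where T: "bij_betw T (space R) (space S)"
      "\<forall>g\<in>carrier G. \<forall>v\<in>space R. T (act R g v) = act S g (T v)"
    using assms(2) unfolding rep_iso_def by blast
  obtain v where "v \<in> space R" "w = T v"
    using T(1) assms(5) by (auto simp: bij_betw_def)
  then show ?thesis using T(2) assms(3,4) by metis
qed

lemma direct_sum_acts_trivially:
  assumes "\<And>i. i \<in> I \<Longrightarrow> complex_rep G (R i)"
    and "\<And>u. u \<in> space (direct_sum I R) \<Longrightarrow> act (direct_sum I R) g u = u"
    and "i \<in> I" "v \<in> space (R i)"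
  shows "act (R i) g v = v"
proof -
  \<comment> \<open>The vector \<open>v\<close> placed in the summand \<open>i\<close>, with 0
    elsewhere; reading the fixed-point equation at coordinate \<open>i\<close> gives the claim for
    \<open>R i\<close>.\<close>
  define u where "u = (\<lambda>j. if j = i then v else 0)"
  have "finite {j. u j \<noteq> 0}"
    by (rule finite_subset[of _ "{i}"]) (auto simp: u_def)
  moreover have "0 \<in> space (R j)" if "j \<in> I" for j
    using assms(1)[OF that] by (simp add: complex_rep_def complex_vector.subspace_0)
  ultimately have "u \<in> space (direct_sum I R)"
    using assms(3,4) by (auto simp: direct_sum_def u_def)
  then have "act (direct_sum I R) g u i = u i" using assms(2) by simp
  then show ?thesis using assms(3) by (simp add: direct_sum_def u_def)
qed

text \<open>Every irreducible representation is isomorphic to a summand of the model, so triviality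
  of \<open>g\<close> passes from \<open>M\<close> to the direct sum, then to the chosen member of
  the class of \<open>R\<close>, and finally back to \<open>R\<close> through the reversed
  isomorphism.\<close>

lemma gelfand_model_acts_trivially:
  assumes "gelfand_model G M" "g \<in> carrier G"
    and "\<And>v. v \<in> space M \<Longrightarrow> act M g v = v"
    and "R \<in> irreps G" "v \<in> space R"
  shows "act R g v = v"
proof -
  let ?E = "{(R, S). R \<in> irreps G \<and> S \<in> irreps G \<and> rep_iso G R S}"
  have rep: "complex_rep G S" if "S \<in> irreps G" for S
    using that by (simp add: irreps_def irreducible_rep_def)
  have class_rep_irrep: "class_rep C \<in> irreps G" if "C \<in> irrep_classes G" for C
    using class_rep_in[OF that] in_quotient_imp_subset[OF equiv_rep_iso_irreps] that
    unfolding irrep_classes_def by blast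
  define C where "C = ?E `` {R}"
  have C: "C \<in> irrep_classes G"
    using assms(4) unfolding C_def irrep_classes_def by (rule quotientI)
  have iso: "rep_iso G R (class_rep C)"
    using class_rep_in[OF C] unfolding C_def by blast
  have "act (direct_sum (irrep_classes G) class_rep) g u = u"
    if "u \<in> space (direct_sum (irrep_classes G) class_rep)" for u
    using assms(1) unfolding gelfand_model_def
    by (metis rep_iso_acts_trivially assms(2,3) that)
  then have "act (class_rep C) g w = w" if "w \<in> space (class_rep C)" for w
    using direct_sum_acts_trivially[where I = "irrep_classes G" and R = class_rep]
      rep class_rep_irrep C that by metis
  then show ?thesis
    using rep_iso_acts_trivially[OF rep[OF class_rep_irrep[OF C]]
        rep_iso_sym[OF rep[OF assms(4)] iso] assms(2)] assms(5) by blast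
qed

theorem proposition7:
  fixes G :: "('g, 'm) monoid_scheme" and L :: "'g \<Rightarrow> 'g"
  assumes "group G" and "finite (carrier G)"
    and "involutive_antiaut G L"
    and "\<forall>g\<in>carrier G. \<exists>x\<in>carrier G. L g = x \<otimes>\<^bsub>G\<^esub> g \<otimes>\<^bsub>G\<^esub> inv\<^bsub>G\<^esub> x"
    and "card (Fix G L) = sum_irrep_dims G"
    and "\<exists>z\<in>carrier G. group.ord G z = 2 \<and> (\<forall>g\<in>carrier G. z \<otimes>\<^bsub>G\<^esub> g = g \<otimes>\<^bsub>G\<^esub> z)"
  shows "\<not> gelfand_model G (natural_rep G L)"
proof
  assume model: "gelfand_model G (natural_rep G L)"
  interpret group G by fact
  obtain z where z: "z \<in> carrier G" "ord z = 2"
      and central: "\<And>g. g \<in> carrier G \<Longrightarrow> z \<otimes>\<^bsub>G\<^esub> g = g \<otimes>\<^bsub>G\<^esub> z"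
    using assms(6) by blast
  have zz: "z \<otimes>\<^bsub>G\<^esub> z = \<one>\<^bsub>G\<^esub>"
    using pow_ord_eq_1[OF z(1)] z by (simp add: numeral_2_eq_2)
  have z1: "z \<noteq> \<one>\<^bsub>G\<^esub>"
    using z(2) ord_eq_1[OF z(1)] by auto
  have inv_z: "inv\<^bsub>G\<^esub> z = z"
    using z(1) zz by (simp add: inv_equality)
  obtain x where x: "x \<in> carrier G" "L z = x \<otimes>\<^bsub>G\<^esub> z \<otimes>\<^bsub>G\<^esub> inv\<^bsub>G\<^esub> x"
    using assms(4) z(1) by blast
  then have Lz: "L z = z"
    using central[OF x(1)] z(1) by (metis inv_solve_right m_closed)
  have "twisted_action G L z h = h" if "h \<in> carrier G" for h
    using that z(1) by (simp add: twisted_action_def Lz inv_z central[OF that] m_assoc zz)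
  then have trivial: "act (natural_rep G L) z f = f" if "f \<in> space (natural_rep G L)" for f
    using that by (auto simp: natural_rep_def fun_eq_iff Fix_def)
  obtain R where R: "R \<in> irreps G" "\<And>v. v \<in> space R \<Longrightarrow> act R z v = - v"
    using exists_irrep_central_involution_acts_as_minus[OF assms(1,2) z(1) zz z1 central] by blast
  \<comment> \<open>On \<open>R\<close> the element \<open>z\<close> acts both as the identity and
    as -1, which over the complex numbers leaves only the zero vector, whereas an irreducible space
    is nonzero.\<close>
  have "v = 0" if "v \<in> space R" for v
  proof -
    have "- v = v"
      using gelfand_model_acts_trivially[OF model z(1) trivial R(1) that] R(2)[OF that] by simp
    then show ?thesis by (auto simp: fun_eq_iff)
  qed
  moreover have "0 \<in> space R" "space R \<noteq> {0}"
    using R(1) by (simp_all add: irreps_def irreducible_rep_def complex_rep_def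
        complex_vector.subspace_0)
  ultimately show False by blast
qed

end
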